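(* Let $N$ be a finitely generated nilpotent group. Then the commutator subgroup $[N,N]$ is bounded in $N$. Consequently, $N$ satisfies the bq-dichotomy.
   Context: For a group $G$ and a finite symmetric set $S\subset G$ such that the set $\overline S$ of conjugates of elements of $S$ generates $G$ (such $G$ is called normally finitely generated), the biinvariant word norm is $\|g\|=\min\{k\ge0 : g=s_1\cdots s_k,\ s_i\in\overline S\}$ (well defined up to Lipschitz equivalence). A subgroup $H\subset G$ is bounded in $G$ if $\sup_{h\in H}\|h\|<\infty$. A homogeneous quasimorphism on $G$ is a function $q\colon G\to\mathbb{R}$ with $\sup_{g,h}|q(gh)-q(g)-q(h)|<\infty$ and $q(g^n)=nq(g)$ for all $g\in G$, $n\in\mathbb{Z}$. A normally finitely generated group $G$ satisfies the bq-dichotomy if for every $g\in G$ either $\langle g\rangle$ is bounded in $G$ or there is a homogeneous quasimorphism $q$ on $G$ with $q(g)\neq0$. *)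

theory Defs
  imports Complex_Main "HOL-Algebra.Generated_Groups"
begin

section \<open>The biinvariant word norm\<close>

definition conjugates :: "('a, 'b) monoid_scheme \<Rightarrow> 'a set \<Rightarrow> 'a set" where
  "conjugates G S = {g \<otimes>\<^bsub>G\<^esub> s \<otimes>\<^bsub>G\<^esub> inv\<^bsub>G\<^esub> g | g s. g \<in> carrier G \<and> s \<in> S}"

definition normal_generating_set :: "('a, 'b) monoid_scheme \<Rightarrow> 'a set \<Rightarrow> bool" where
  "normal_generating_set G S \<longleftrightarrow>
     finite S \<and> S \<subseteq> carrier G \<and> (\<forall>s\<in>S. inv\<^bsub>G\<^esub> s \<in> S) \<and>
     generate G (conjugates G S) = carrier G"

definition normally_finitely_generated :: "('a, 'b) monoid_scheme \<Rightarrow> bool" where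
  "normally_finitely_generated G \<longleftrightarrow> (\<exists>S. normal_generating_set G S)"

text \<open>The minimum is taken over a nonempty set whenever \<open>S\<close> is a normal generating set and
  \<open>g\<close> lies in the group; see \<open>conjugate_word_exists\<close> below.\<close>

definition word_norm :: "('a, 'b) monoid_scheme \<Rightarrow> 'a set \<Rightarrow> 'a \<Rightarrow> nat" where
  "word_norm G S g =
     (LEAST k. \<exists>w. length w = k \<and> set w \<subseteq> conjugates G S \<and> g = foldr (\<otimes>\<^bsub>G\<^esub>) w \<one>\<^bsub>G\<^esub>)"

text \<open>The word norms of two normal generating sets are Lipschitz equivalent, so boundedness does
  not depend on the generating set: \<open>bounded_subgroup_iff\<close> below shows that quantifying over
  all of them amounts to using any single one. Normal finite generation is part of the definition
  because without it the quantification would be vacuous.\<close>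

definition bounded_subgroup :: "('a, 'b) monoid_scheme \<Rightarrow> 'a set \<Rightarrow> bool" where
  "bounded_subgroup G H \<longleftrightarrow>
     normally_finitely_generated G \<and> subgroup H G \<and>
     (\<forall>S. normal_generating_set G S \<longrightarrow> bdd_above (word_norm G S ` H))"


section \<open>Homogeneous quasimorphisms and the bq-dichotomy\<close>

definition homogeneous_quasimorphism :: "('a, 'b) monoid_scheme \<Rightarrow> ('a \<Rightarrow> real) \<Rightarrow> bool" where
  "homogeneous_quasimorphism G q \<longleftrightarrow>
     (\<exists>D. \<forall>g\<in>carrier G. \<forall>h\<in>carrier G. \<bar>q (g \<otimes>\<^bsub>G\<^esub> h) - q g - q h\<bar> \<le> D) \<and>
     (\<forall>g\<in>carrier G. \<forall>n::int. q (g [^]\<^bsub>G\<^esub> n) = of_int n * q g)"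

definition bq_dichotomy :: "('a, 'b) monoid_scheme \<Rightarrow> bool" where
  "bq_dichotomy G \<longleftrightarrow>
     normally_finitely_generated G \<and>
     (\<forall>g\<in>carrier G. bounded_subgroup G (generate G {g}) \<or>
        (\<exists>q. homogeneous_quasimorphism G q \<and> q g \<noteq> 0))"


section \<open>Finitely generated and nilpotent groups\<close>

definition finitely_generated_group :: "('a, 'b) monoid_scheme \<Rightarrow> bool" where
  "finitely_generated_group G \<longleftrightarrow>
     group G \<and> (\<exists>S. finite S \<and> S \<subseteq> carrier G \<and> generate G S = carrier G)"

definition commutator_subgroup ::
    "('a, 'b) monoid_scheme \<Rightarrow> 'a set \<Rightarrow> 'a set \<Rightarrow> 'a set" where
  "commutator_subgroup G A B =
     generate G {a \<otimes>\<^bsub>G\<^esub> b \<otimes>\<^bsub>G\<^esub> inv\<^bsub>G\<^esub> a \<otimes>\<^bsub>G\<^esub> inv\<^bsub>G\<^esub> b | a b. a \<in> A \<and> b \<in> B}"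

text \<open>The index is shifted by one from the usual convention: the zeroth term is the whole group.\<close>

primrec lower_central_series :: "('a, 'b) monoid_scheme \<Rightarrow> nat \<Rightarrow> 'a set" where
  "lower_central_series G 0 = carrier G"
| "lower_central_series G (Suc n) =
     commutator_subgroup G (lower_central_series G n) (carrier G)"

definition nilpotent_group :: "('a, 'b) monoid_scheme \<Rightarrow> bool" where
  "nilpotent_group G \<longleftrightarrow> group G \<and> (\<exists>n. lower_central_series G n = {\<one>\<^bsub>G\<^esub>})"

lemma commutator_subgroup_self: "commutator_subgroup G H H = derived G H"
  unfolding commutator_subgroup_def derived_def by (rule arg_cong[where f = "generate G"]) auto


section \<open>Independence of the generating set\<close>

context group
begin

lemma conjugates_closed: "S \<subseteq> carrier G \<Longrightarrow> conjugates G S \<subseteq> carrier G"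
  unfolding conjugates_def by auto

lemma conjugates_inv:
  assumes "S \<subseteq> carrier G" "\<forall>s\<in>S. inv s \<in> S" "x \<in> conjugates G S"
  shows "inv x \<in> conjugates G S"
proof -
  obtain g s where gs: "x = g \<otimes> s \<otimes> inv g" "g \<in> carrier G" "s \<in> S"
    using assms(3) unfolding conjugates_def by auto
  then have "inv x = g \<otimes> inv s \<otimes> inv g"
    using assms(1) by (auto simp: inv_mult_group m_assoc subset_iff)
  then show ?thesis
    using gs assms(2) unfolding conjugates_def by blast
qed

lemma conjugates_conj:
  assumes "S \<subseteq> carrier G" "x \<in> conjugates G S" "a \<in> carrier G"
  shows "a \<otimes> x \<otimes> inv a \<in> conjugates G S"
proof -
  obtain g s where gs: "x = g \<otimes> s \<otimes> inv g" "g \<in> carrier G" "s \<in> S"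
    using assms(2) unfolding conjugates_def by auto
  then have "a \<otimes> x \<otimes> inv a = (a \<otimes> g) \<otimes> s \<otimes> inv (a \<otimes> g)"
    using assms(1,3) by (auto simp: inv_mult_group m_assoc subset_iff)
  then show ?thesis
    using gs assms(3) unfolding conjugates_def by blast
qed

lemma foldr_mult_closed: "set w \<subseteq> carrier G \<Longrightarrow> foldr (\<otimes>) w \<one> \<in> carrier G"
  by (induction w) auto

lemma foldr_mult_append:
  "set v \<subseteq> carrier G \<Longrightarrow> set w \<subseteq> carrier G \<Longrightarrow>
    foldr (\<otimes>) (v @ w) \<one> = foldr (\<otimes>) v \<one> \<otimes> foldr (\<otimes>) w \<one>"
  by (induction v) (simp_all add: m_assoc foldr_mult_closed del: foldr_append)

lemma conjugate_word_exists:
  assumes "normal_generating_set G S" "g \<in> carrier G"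
  shows "\<exists>w. set w \<subseteq> conjugates G S \<and> g = foldr (\<otimes>) w \<one>"
proof -
  have S: "S \<subseteq> carrier G" "\<forall>s\<in>S. inv s \<in> S" and "g \<in> generate G (conjugates G S)"
    using assms unfolding normal_generating_set_def by auto
  from this(3) show ?thesis
  proof (induction rule: generate.induct)
    case one
    then show ?case by (intro exI[of _ "[]"]) auto
  next
    case (incl h)
    then show ?case using conjugates_closed[OF S(1)] by (intro exI[of _ "[h]"]) auto
  next
    case (inv h)
    then show ?case using conjugates_inv[OF S inv] conjugates_closed[OF S(1)]
      by (intro exI[of _ "[inv h]"]) auto
  next
    case (eng h1 h2)
    then obtain v w where "set v \<subseteq> conjugates G S" "h1 = foldr (\<otimes>) v \<one>"
      "set w \<subseteq> conjugates G S" "h2 = foldr (\<otimes>) w \<one>" by blast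
    then show ?case using conjugates_closed[OF S(1)] foldr_mult_append[of v w]
      by (intro exI[of _ "v @ w"]) (auto simp del: foldr_append)
  qed
qed

lemma word_norm_word:
  assumes "normal_generating_set G S" "g \<in> carrier G"
  obtains w where "length w = word_norm G S g" "set w \<subseteq> conjugates G S" "g = foldr (\<otimes>) w \<one>"
proof -
  have "\<exists>k w. length w = k \<and> set w \<subseteq> conjugates G S \<and> g = foldr (\<otimes>) w \<one>"
    using conjugate_word_exists[OF assms] by blast
  from LeastI_ex[OF this] show ?thesis
    using that unfolding word_norm_def by blast
qed

lemma word_norm_le:
  assumes "set w \<subseteq> conjugates G S"
  shows "word_norm G S (foldr (\<otimes>) w \<one>) \<le> length w"
  unfolding word_norm_def using assms by (intro Least_le) blast

lemma word_norm_mult_le: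
  assumes "normal_generating_set G S" "g \<in> carrier G" "h \<in> carrier G"
  shows "word_norm G S (g \<otimes> h) \<le> word_norm G S g + word_norm G S h"
proof -
  have S: "S \<subseteq> carrier G" using assms(1) unfolding normal_generating_set_def by auto
  obtain v where v: "length v = word_norm G S g" "set v \<subseteq> conjugates G S" "g = foldr (\<otimes>) v \<one>"
    using word_norm_word[OF assms(1,2)] .
  obtain w where w: "length w = word_norm G S h" "set w \<subseteq> conjugates G S" "h = foldr (\<otimes>) w \<one>"
    using word_norm_word[OF assms(1,3)] .
  have "g \<otimes> h = foldr (\<otimes>) (v @ w) \<one>"
    using foldr_mult_append[of v w] v w conjugates_closed[OF S] by (simp del: foldr_append)
  then show ?thesis
    using word_norm_le[of "v @ w" S] v w by (simp del: foldr_append)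
qed

lemma word_norm_one: "word_norm G S \<one> = 0"
  using word_norm_le[of "[]" S] by simp

lemma foldr_mult_conj:
  assumes "set w \<subseteq> carrier G" "a \<in> carrier G"
  shows "a \<otimes> foldr (\<otimes>) w \<one> \<otimes> inv a = foldr (\<otimes>) (map (\<lambda>x. a \<otimes> x \<otimes> inv a) w) \<one>"
  using assms(1)
proof (induction w)
  case Nil
  then show ?case using assms(2) by simp
next
  case (Cons x w)
  have "a \<otimes> (x \<otimes> foldr (\<otimes>) w \<one>) \<otimes> inv a = (a \<otimes> x \<otimes> inv a) \<otimes> (a \<otimes> foldr (\<otimes>) w \<one> \<otimes> inv a)"
    using Cons.prems assms(2) foldr_mult_closed[of w] by (simp add: inv_solve_left m_assoc)
  then show ?case using Cons by simp
qed

lemma word_norm_conj_le: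
  assumes "normal_generating_set G S" "g \<in> carrier G" "a \<in> carrier G"
  shows "word_norm G S (a \<otimes> g \<otimes> inv a) \<le> word_norm G S g"
proof -
  have S: "S \<subseteq> carrier G" using assms(1) unfolding normal_generating_set_def by auto
  obtain w where w: "length w = word_norm G S g" "set w \<subseteq> conjugates G S" "g = foldr (\<otimes>) w \<one>"
    using word_norm_word[OF assms(1,2)] .
  have "a \<otimes> g \<otimes> inv a = foldr (\<otimes>) (map (\<lambda>x. a \<otimes> x \<otimes> inv a) w) \<one>"
    using foldr_mult_conj[of w a] w assms(3) conjugates_closed[OF S] by simp
  moreover have "set (map (\<lambda>x. a \<otimes> x \<otimes> inv a) w) \<subseteq> conjugates G S"
    using w conjugates_conj[OF S _ assms(3)] by auto
  ultimately show ?thesis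
    using word_norm_le[of "map (\<lambda>x. a \<otimes> x \<otimes> inv a) w" S] w by simp
qed

lemma word_norm_Lipschitz:
  assumes S: "normal_generating_set G S" and T: "normal_generating_set G T"
  shows "\<exists>C. \<forall>g\<in>carrier G. word_norm G T g \<le> C * word_norm G S g"
proof -
  have fin: "finite S" "S \<subseteq> carrier G" using S unfolding normal_generating_set_def by auto
  obtain C where C: "\<And>s. s \<in> S \<Longrightarrow> word_norm G T s \<le> C"
    using finite_nat_set_iff_bounded_le[of "word_norm G T ` S"] fin by auto
  have Cconj: "word_norm G T x \<le> C" if x: "x \<in> conjugates G S" for x
  proof -
    obtain a s where "x = a \<otimes> s \<otimes> inv a" "a \<in> carrier G" "s \<in> S"
      using x unfolding conjugates_def by auto
    then show ?thesis
      using word_norm_conj_le[OF T, of s a] C[of s] fin by auto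
  qed
  have word: "word_norm G T (foldr (\<otimes>) w \<one>) \<le> C * length w" if "set w \<subseteq> conjugates G S" for w
    using that
  proof (induction w)
    case Nil
    then show ?case by (simp add: word_norm_one)
  next
    case (Cons x w)
    then have "x \<in> carrier G" "set w \<subseteq> carrier G"
      using conjugates_closed[OF fin(2)] by auto
    then have "word_norm G T (x \<otimes> foldr (\<otimes>) w \<one>)
        \<le> word_norm G T x + word_norm G T (foldr (\<otimes>) w \<one>)"
      by (intro word_norm_mult_le[OF T] foldr_mult_closed)
    then show ?case using Cons Cconj[of x] by simp
  qed
  have "word_norm G T g \<le> C * word_norm G S g" if g: "g \<in> carrier G" for g
  proof -
    obtain w where "length w = word_norm G S g" "set w \<subseteq> conjugates G S" "g = foldr (\<otimes>) w \<one>"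
      using word_norm_word[OF S g] .
    then show ?thesis using word[of w] by simp
  qed
  then show ?thesis by blast
qed

lemma bounded_subgroup_iff:
  assumes "normal_generating_set G S"
  shows "bounded_subgroup G H \<longleftrightarrow> subgroup H G \<and> bdd_above (word_norm G S ` H)"
proof (intro iffI)
  assume "bounded_subgroup G H"
  then show "subgroup H G \<and> bdd_above (word_norm G S ` H)"
    using assms unfolding bounded_subgroup_def by simp
next
  assume H: "subgroup H G \<and> bdd_above (word_norm G S ` H)"
  then obtain B where B: "\<And>h. h \<in> H \<Longrightarrow> word_norm G S h \<le> B"
    unfolding bdd_above_def by auto
  have "bdd_above (word_norm G T ` H)" if T: "normal_generating_set G T" for T
  proof -
    obtain C where C: "\<forall>g\<in>carrier G. word_norm G T g \<le> C * word_norm G S g"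
      using word_norm_Lipschitz[OF assms T] by blast
    have "word_norm G T h \<le> C * B" if h: "h \<in> H" for h
    proof -
      have "word_norm G T h \<le> C * word_norm G S h"
        using C H h subgroup.subset[of H G] by blast
      also have "\<dots> \<le> C * B"
        using B[OF h] by simp
      finally show ?thesis .
    qed
    then show ?thesis by (auto intro!: bdd_aboveI[of _ "C * B"])
  qed
  then show "bounded_subgroup G H"
    using H assms unfolding bounded_subgroup_def normally_finitely_generated_def by blast
qed

end

end

theory Submission
  imports Defs "HOL-Algebra.Zassenhaus"
begin

text \<open>
  Write \<open>[a, g] = a g a\<^sup>-\<^sup>1 g\<^sup>-\<^sup>1\<close>. A commutator \<open>[a, s] = (a s a\<^sup>-\<^sup>1) s\<^sup>-\<^sup>1\<close> has word norm at most
  \<open>\<parallel>s\<parallel> + \<parallel>s\<^sup>-\<^sup>1\<parallel>\<close>, uniformly in \<open>a\<close>, because the norm is conjugation invariant. This alone does not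
  bound \<open>[N, N]\<close>, whose elements are products of arbitrarily many commutators. Nilpotency
  together with finite generation bounds the number of factors needed. Let \<open>A\<close> be a
  term of the lower central series, \<open>C = [A, N]\<close> the next one and \<open>D = [C, N]\<close> the one after that. Modulo \<open>D\<close> the group \<open>C\<close> is central, so the commutator map
  \<open>A \<times> N \<rightarrow> C / D\<close> is multiplicative in both variables. Multiplicativity in the second variable
  reduces it to a finite generating set \<open>S\<close>, and multiplicativity in the first collects all
  commutators with the same \<open>s \<in> S\<close> into a single one. Hence every element of \<open>C\<close> is a product of
  \<open>card S\<close> commutators \<open>[a\<^sub>s, s]\<close> and an element of \<open>D\<close>, and if \<open>D\<close> is bounded then so is \<open>C\<close>
  (\<open>bounded_commutator_subgroup_step\<close>). Climbing up from the trivial last term of the series one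
  reaches \<open>[N, N]\<close>.

  For the dichotomy, let \<open>g \<in> N\<close>. If \<open>g\<^sup>n \<in> [N, N]\<close> for some \<open>n > 0\<close>, then the powers of
  \<open>g\<close> differ from elements of the bounded group \<open>[N, N]\<close> by one of the finitely many \<open>g\<^sup>r\<close> with
  \<open>0 \<le> r < n\<close>, so the cyclic group generated by \<open>g\<close> is bounded. Otherwise \<open>g\<close> has infinite order in
  the finitely generated abelian group \<open>N / [N, N]\<close>. The map \<open>g\<^sup>k \<mapsto> k\<close> extends to a homomorphism
  \<open>N / [N, N] \<rightarrow> \<real>\<close>, one generator at a time, because \<open>\<real>\<close> is divisible
  (\<open>real_hom_nonzero_on_infinite_order\<close>); its composition with the projection is a homogeneous
  quasimorphism that does not vanish at \<open>g\<close>.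
\<close>

section \<open>Commutators\<close>

context group
begin

definition commutator :: "'a \<Rightarrow> 'a \<Rightarrow> 'a" where
  "commutator a b = a \<otimes> b \<otimes> inv a \<otimes> inv b"

lemma commutator_closed [simp, intro]:
  "a \<in> carrier G \<Longrightarrow> b \<in> carrier G \<Longrightarrow> commutator a b \<in> carrier G"
  unfolding commutator_def by simp

lemma cancel_inv_left [simp]:
  "x \<in> carrier G \<Longrightarrow> y \<in> carrier G \<Longrightarrow> inv x \<otimes> (x \<otimes> y) = y"
  "x \<in> carrier G \<Longrightarrow> y \<in> carrier G \<Longrightarrow> x \<otimes> (inv x \<otimes> y) = y"
  by (simp_all flip: m_assoc)

lemma commutator_one_right: "a \<in> carrier G \<Longrightarrow> commutator a \<one> = \<one>"
  unfolding commutator_def by simp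

lemma commutator_one_left: "a \<in> carrier G \<Longrightarrow> commutator \<one> a = \<one>"
  unfolding commutator_def by simp

lemma inv_commutator:
  "a \<in> carrier G \<Longrightarrow> b \<in> carrier G \<Longrightarrow> inv (commutator a b) = commutator b a"
  unfolding commutator_def by (simp add: inv_mult_group m_assoc)

lemma commutator_mult_right:
  "\<lbrakk>a \<in> carrier G; g \<in> carrier G; h \<in> carrier G\<rbrakk>
    \<Longrightarrow> commutator a (g \<otimes> h) = commutator a g \<otimes> (g \<otimes> commutator a h \<otimes> inv g)"
  unfolding commutator_def by (simp add: inv_mult_group m_assoc)

lemma commutator_inv_right:
  "\<lbrakk>a \<in> carrier G; g \<in> carrier G\<rbrakk>
    \<Longrightarrow> commutator a (inv g) = inv g \<otimes> inv (commutator a g) \<otimes> inv (inv g)"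
  unfolding commutator_def by (simp add: inv_mult_group m_assoc)

text \<open>Up to the first two factors, which are commutators having a commutator as an entry and hence
  vanish modulo the third term of the series, \<open>a \<mapsto> [a, s]\<close> is multiplicative.\<close>

lemma commutator_mult_left:
  "\<lbrakk>a \<in> carrier G; b \<in> carrier G; s \<in> carrier G\<rbrakk>
    \<Longrightarrow> commutator (a \<otimes> b) s =
      inv (commutator (commutator b s) a) \<otimes> commutator (commutator b s) (commutator a s)
        \<otimes> (commutator a s \<otimes> commutator b s)"
  unfolding commutator_def by (simp add: inv_mult_group m_assoc)

lemma conj_commutator:
  "\<lbrakk>a \<in> carrier G; b \<in> carrier G; g \<in> carrier G\<rbrakk>
    \<Longrightarrow> g \<otimes> commutator a b \<otimes> inv g
        = commutator (g \<otimes> a \<otimes> inv g) (g \<otimes> b \<otimes> inv g)"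
  unfolding commutator_def by (simp add: inv_mult_group m_assoc)

lemma commutator_subgroup_eq:
  "commutator_subgroup G A B = generate G {commutator a b | a b. a \<in> A \<and> b \<in> B}"
  unfolding commutator_subgroup_def commutator_def ..

lemma commutator_in_commutator_subgroup:
  "a \<in> A \<Longrightarrow> b \<in> B \<Longrightarrow> commutator a b \<in> commutator_subgroup G A B"
  unfolding commutator_subgroup_eq by (intro generate.incl) blast

lemma commutator_subgroup_normal:
  assumes "A \<lhd> G"
  shows "commutator_subgroup G A (carrier G) \<lhd> G"
proof -
  interpret A: normal A G by fact
  show ?thesis
    unfolding commutator_subgroup_eq
  proof (rule normal_generateI)
    show "{commutator a b | a b. a \<in> A \<and> b \<in> carrier G} \<subseteq> carrier G"
      using A.subset by auto
    fix h g assume "h \<in> {commutator a b | a b. a \<in> A \<and> b \<in> carrier G}" and g: "g \<in> carrier G"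
    then obtain a b where ab: "a \<in> A" "b \<in> carrier G" "h = commutator a b" by blast
    then have "g \<otimes> h \<otimes> inv g = commutator (g \<otimes> a \<otimes> inv g) (g \<otimes> b \<otimes> inv g)"
      using conj_commutator[of a b g] A.subset g by auto
    moreover have "g \<otimes> a \<otimes> inv g \<in> A" using A.inv_op_closed2 ab g by blast
    ultimately show "g \<otimes> h \<otimes> inv g \<in> {commutator a b | a b. a \<in> A \<and> b \<in> carrier G}"
      using ab g by blast
  qed
qed

lemma commutator_subgroup_subset:
  assumes "A \<lhd> G"
  shows "commutator_subgroup G A (carrier G) \<subseteq> A"
proof -
  interpret A: normal A G by fact
  have "commutator a b \<in> A" if "a \<in> A" "b \<in> carrier G" for a b
  proof -
    have "commutator a b = a \<otimes> (b \<otimes> inv a \<otimes> inv b)"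
      using that A.subset by (auto simp: commutator_def m_assoc)
    then show ?thesis using that A.inv_op_closed2[of b "inv a"] by simp
  qed
  then show ?thesis
    unfolding commutator_subgroup_eq
    by (intro generate_subgroup_incl A.subgroup_axioms) blast
qed

text \<open>Modulo \<open>[C, G]\<close> the elements of \<open>C\<close> are central, so conjugation does not move them.\<close>

lemma normal_between_commutator_subgroup:
  assumes "subgroup K G" "commutator_subgroup G C (carrier G) \<subseteq> K" "K \<subseteq> C" "C \<subseteq> carrier G"
  shows "K \<lhd> G"
proof (rule normal_invI)
  show "subgroup K G" by fact
  fix g x assume g: "g \<in> carrier G" and x: "x \<in> K"
  interpret K: subgroup K G by fact
  have xG: "x \<in> carrier G" using x by simp
  have "commutator x g \<in> K"
    using commutator_in_commutator_subgroup[of x C g "carrier G"] assms g x by blast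
  then have "inv (commutator x g) \<otimes> x \<in> K" using x by simp
  also have "inv (commutator x g) \<otimes> x = g \<otimes> x \<otimes> inv g"
    using xG g by (simp add: inv_commutator) (simp add: commutator_def m_assoc)
  finally show "g \<otimes> x \<otimes> inv g \<in> K" .
qed


section \<open>Boundedness along the lower central series\<close>

text \<open>The commutators with a fixed second entry form a subgroup modulo \<open>D\<close>, since \<open>a \<mapsto> [a, s]\<close> is a
  homomorphism from \<open>A\<close> to \<open>C / D\<close>. This is what keeps the number of commutators bounded.\<close>

lemma commutators_fixed_right_subgroup:
  fixes A
  defines "C \<equiv> commutator_subgroup G A (carrier G)"
  defines "D \<equiv> commutator_subgroup G C (carrier G)"
  assumes A: "A \<lhd> G" and s: "s \<in> carrier G"
  shows "subgroup (D <#> (\<lambda>a. commutator a s) ` A) G"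
proof -
  interpret A: normal A G by fact
  have C: "C \<lhd> G" unfolding C_def by (rule commutator_subgroup_normal[OF A])
  then have "D \<lhd> G" unfolding D_def by (rule commutator_subgroup_normal)
  then interpret D: normal D G .
  have AG: "a \<in> carrier G" if "a \<in> A" for a using that A.subset by blast
  let ?P = "D <#> (\<lambda>a. commutator a s) ` A"
  have P: "x \<in> ?P \<longleftrightarrow> (\<exists>d\<in>D. \<exists>a\<in>A. x = d \<otimes> commutator a s)" for x
    unfolding set_mult_def by blast
  have mult: "\<exists>d\<in>D. commutator a s \<otimes> commutator b s = d \<otimes> commutator (a \<otimes> b) s"
    if ab: "a \<in> A" "b \<in> A" for a b
  proof -
    have bC: "commutator b s \<in> C"
      unfolding C_def using ab s by (intro commutator_in_commutator_subgroup)
    define d where "d = inv (commutator (commutator b s) a)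
      \<otimes> commutator (commutator b s) (commutator a s)"
    have d: "d \<in> D"
      unfolding d_def using bC ab s AG
      by (intro D.m_closed D.m_inv_closed) (auto simp: D_def intro!: commutator_in_commutator_subgroup)
    have "commutator (a \<otimes> b) s = d \<otimes> (commutator a s \<otimes> commutator b s)"
      unfolding d_def using ab s AG by (intro commutator_mult_left) auto
    then have "commutator a s \<otimes> commutator b s = inv d \<otimes> commutator (a \<otimes> b) s"
      using d ab s AG by simp
    then show ?thesis using d by blast
  qed
  show ?thesis
  proof (rule subgroupI)
    show "?P \<subseteq> carrier G" using s AG unfolding set_mult_def by auto
    show "?P \<noteq> {}" using P D.one_closed A.one_closed by blast
  next
    fix x assume "x \<in> ?P"
    then obtain d a where x: "d \<in> D" "a \<in> A" "x = d \<otimes> commutator a s" using P by blast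
    from mult[OF A.m_inv_closed[OF x(2)] x(2)]
    obtain e where e: "e \<in> D" "commutator (inv a) s \<otimes> commutator a s = e"
      using x s AG by (auto simp: commutator_one_left)
    have "inv x = (inv e \<otimes> (commutator (inv a) s \<otimes> inv d \<otimes> inv (commutator (inv a) s)))
        \<otimes> commutator (inv a) s"
      unfolding e(2)[symmetric] using x s AG by (simp add: inv_mult_group m_assoc)
    moreover have "inv e \<otimes> (commutator (inv a) s \<otimes> inv d \<otimes> inv (commutator (inv a) s)) \<in> D"
      using e x s AG by (intro D.m_closed D.m_inv_closed D.inv_op_closed2) auto
    ultimately show "inv x \<in> ?P" using P x by blast
  next
    fix x y assume "x \<in> ?P" "y \<in> ?P"
    then obtain d a e b where x: "d \<in> D" "a \<in> A" "x = d \<otimes> commutator a s"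
      and y: "e \<in> D" "b \<in> A" "y = e \<otimes> commutator b s" using P by meson
    obtain f where f: "f \<in> D" "commutator a s \<otimes> commutator b s = f \<otimes> commutator (a \<otimes> b) s"
      using mult x y by blast
    have "x \<otimes> y = d \<otimes> (commutator a s \<otimes> e \<otimes> inv (commutator a s))
        \<otimes> (commutator a s \<otimes> commutator b s)"
      using x y s AG by (simp add: m_assoc)
    also have "\<dots> = (d \<otimes> (commutator a s \<otimes> e \<otimes> inv (commutator a s)) \<otimes> f)
        \<otimes> commutator (a \<otimes> b) s"
      unfolding f(2) using x y f s AG by (simp add: m_assoc)
    finally have "x \<otimes> y = (d \<otimes> (commutator a s \<otimes> e \<otimes> inv (commutator a s)) \<otimes> f)
        \<otimes> commutator (a \<otimes> b) s" .
    moreover have "d \<otimes> (commutator a s \<otimes> e \<otimes> inv (commutator a s)) \<otimes> f \<in> D"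
      using x y f s AG by (intro D.m_closed D.inv_op_closed2) auto
    ultimately show "x \<otimes> y \<in> ?P" using P x y by blast
  qed
qed

lemma word_norm_commutator_le:
  assumes T: "normal_generating_set G T" and "a \<in> carrier G" "s \<in> carrier G"
  shows "word_norm G T (commutator a s) \<le> word_norm G T s + word_norm G T (inv s)"
  using word_norm_mult_le[OF T, of "a \<otimes> s \<otimes> inv a" "inv s"] word_norm_conj_le[OF T, of s a] assms
  unfolding commutator_def by simp

lemma bounded_set_mult:
  assumes T: "normal_generating_set G T"
    and "X \<subseteq> carrier G" "bdd_above (word_norm G T ` X)"
    and "Y \<subseteq> carrier G" "bdd_above (word_norm G T ` Y)"
  shows "bdd_above (word_norm G T ` (X <#> Y))"
proof -
  obtain B B' where B: "\<And>x. x \<in> X \<Longrightarrow> word_norm G T x \<le> B"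
    and B': "\<And>y. y \<in> Y \<Longrightarrow> word_norm G T y \<le> B'"
    using assms(3,5) unfolding bdd_above_def by auto
  have "word_norm G T z \<le> B + B'" if z: "z \<in> X <#> Y" for z
  proof -
    obtain x y where xy: "x \<in> X" "y \<in> Y" "z = x \<otimes> y" using z unfolding set_mult_def by blast
    then have "word_norm G T z \<le> word_norm G T x + word_norm G T y"
      using word_norm_mult_le[OF T, of x y] assms(2,4) by blast
    then show ?thesis using add_mono[OF B[OF xy(1)] B'[OF xy(2)]] by (rule order_trans)
  qed
  then show ?thesis by (rule bdd_aboveI2)
qed

text \<open>A commutator \<open>[a, s]\<close> has norm bounded independently of \<open>a\<close>, so each of the subgroups from
  \<open>commutators_fixed_right_subgroup\<close> is bounded, and so is their product over the finite set \<open>S\<close>.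
  Every subgroup between \<open>D\<close> and \<open>C\<close> is normal, so the product is again a subgroup.\<close>

lemma bounded_subgroup_with_commutators:
  fixes A
  defines "C \<equiv> commutator_subgroup G A (carrier G)"
  defines "D \<equiv> commutator_subgroup G C (carrier G)"
  assumes A: "A \<lhd> G" and T: "normal_generating_set G T"
    and D: "bdd_above (word_norm G T ` D)"
    and "finite S" "S \<subseteq> carrier G"
  shows "\<exists>K. subgroup K G \<and> D \<subseteq> K \<and> K \<subseteq> C \<and> bdd_above (word_norm G T ` K)
    \<and> (\<forall>s\<in>S. \<forall>a\<in>A. commutator a s \<in> K)"
  using assms(6,7)
proof (induction rule: finite_induct)
  case empty
  have C: "C \<lhd> G" unfolding C_def by (rule commutator_subgroup_normal[OF A])
  then have "D \<lhd> G" "D \<subseteq> C"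
    unfolding D_def by (rule commutator_subgroup_normal, rule commutator_subgroup_subset)
  then show ?case using D by (intro exI[of _ D]) (simp add: normal_imp_subgroup)
next
  case (insert s S)
  then have s: "s \<in> carrier G" by simp
  have CN: "C \<lhd> G" unfolding C_def by (rule commutator_subgroup_normal[OF A])
  then interpret C: normal C G .
  have DN: "D \<lhd> G" "D \<subseteq> C"
    using CN unfolding D_def by (rule commutator_subgroup_normal, rule commutator_subgroup_subset)
  interpret D: normal D G by fact
  have AG: "A \<subseteq> carrier G" using A by (simp add: normal_imp_subgroup subgroup.subset)
  obtain K where K: "subgroup K G" "D \<subseteq> K" "K \<subseteq> C" "bdd_above (word_norm G T ` K)"
    "\<forall>s\<in>S. \<forall>a\<in>A. commutator a s \<in> K"
    using insert by auto
  interpret K: subgroup K G by fact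
  define P where "P = D <#> (\<lambda>a. commutator a s) ` A"
  have P: "subgroup P G"
    unfolding P_def C_def D_def by (rule commutators_fixed_right_subgroup[OF A s])
  interpret P: subgroup P G by fact
  have comm_C: "commutator a s \<in> C" if "a \<in> A" for a
    unfolding C_def using that s by (intro commutator_in_commutator_subgroup)
  have "P \<subseteq> C" unfolding P_def set_mult_def using DN(2) comm_C by auto
  have "bdd_above (word_norm G T ` (\<lambda>a. commutator a s) ` A)"
    using word_norm_commutator_le[OF T _ s] AG unfolding image_image by (intro bdd_aboveI2) auto
  then have bddP: "bdd_above (word_norm G T ` P)"
    unfolding P_def using D D.subset AG s by (intro bounded_set_mult[OF T]) auto
  have inP: "commutator a s \<in> P" if "a \<in> A" for a
  proof -
    have "commutator a s = \<one> \<otimes> commutator a s" using that AG s by (simp add: subset_iff)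
    then show ?thesis unfolding P_def set_mult_def using that D.one_closed by blast
  qed
  have "K \<lhd> G"
    using normal_between_commutator_subgroup[of K C] K(1-3) C.subset unfolding D_def by blast
  then have "subgroup (K <#> P) G" by (rule mult_norm_subgroup[OF _ P])
  moreover have KKP: "K \<subseteq> K <#> P"
  proof
    fix x assume x: "x \<in> K"
    then have "x \<otimes> \<one> \<in> K <#> P" unfolding set_mult_def using P.one_closed by blast
    then show "x \<in> K <#> P" using x by simp
  qed
  moreover have PKP: "P \<subseteq> K <#> P"
  proof
    fix x assume x: "x \<in> P"
    then have "\<one> \<otimes> x \<in> K <#> P" unfolding set_mult_def using K.one_closed by blast
    then show "x \<in> K <#> P" using x by simp
  qed
  moreover have "K <#> P \<subseteq> C"
    unfolding set_mult_def using K(3) \<open>P \<subseteq> C\<close> by auto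
  moreover have "bdd_above (word_norm G T ` (K <#> P))"
    using K(4) bddP K.subset P.subset by (intro bounded_set_mult[OF T])
  moreover have "\<forall>t\<in>insert s S. \<forall>a\<in>A. commutator a t \<in> K <#> P"
    using K(5) inP KKP PKP by blast
  ultimately show ?case using subset_trans[OF K(2) KKP] by (intro exI[of _ "K <#> P"]) blast
qed

text \<open>By multiplicativity in the second entry, the elements \<open>g\<close> with \<open>[A, g] \<subseteq> K\<close> form a subgroup; it
  contains a generating set, so the bounded subgroup \<open>K\<close> contains all of \<open>[A, G]\<close>.\<close>

lemma bounded_commutator_subgroup_step:
  fixes A
  defines "C \<equiv> commutator_subgroup G A (carrier G)"
  assumes A: "A \<lhd> G" and T: "normal_generating_set G T"
    and S: "finite S" "S \<subseteq> carrier G" "generate G S = carrier G"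
    and D: "bdd_above (word_norm G T ` commutator_subgroup G C (carrier G))"
  shows "bdd_above (word_norm G T ` C)"
proof -
  have CG: "C \<subseteq> carrier G"
    unfolding C_def using commutator_subgroup_normal[OF A]
    by (simp add: normal_imp_subgroup subgroup.subset)
  have AG: "A \<subseteq> carrier G" using A by (simp add: normal_imp_subgroup subgroup.subset)
  obtain K where K: "subgroup K G" "commutator_subgroup G C (carrier G) \<subseteq> K" "K \<subseteq> C"
    "bdd_above (word_norm G T ` K)" "\<forall>s\<in>S. \<forall>a\<in>A. commutator a s \<in> K"
    using bounded_subgroup_with_commutators[OF A T D[unfolded C_def] S(1,2)] unfolding C_def by blast
  have "K \<lhd> G" using normal_between_commutator_subgroup[OF K(1-3) CG] .
  then interpret K: normal K G .
  have "\<forall>a\<in>A. commutator a g \<in> K" if g: "g \<in> generate G S" for g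
    using g
  proof (induction rule: generate.induct)
    case one
    then show ?case using AG by (auto simp: commutator_one_right)
  next
    case (incl h)
    then show ?case using K(5) by blast
  next
    case (inv h)
    show ?case
    proof
      fix a assume a: "a \<in> A"
      have h: "h \<in> carrier G" using inv S by blast
      have "inv h \<otimes> inv (commutator a h) \<otimes> inv (inv h) \<in> K"
        using K(5) inv a h by (intro K.inv_op_closed2 K.m_inv_closed) auto
      then show "commutator a (inv h) \<in> K"
        using commutator_inv_right[of a h] a h AG by auto
    qed
  next
    case (eng h1 h2)
    have h: "h1 \<in> carrier G" "h2 \<in> carrier G" using eng S by auto
    show ?case
    proof
      fix a assume a: "a \<in> A"
      then have "commutator a h1 \<otimes> (h1 \<otimes> commutator a h2 \<otimes> inv h1) \<in> K"
        using eng h by (intro K.m_closed K.inv_op_closed2) auto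
      then show "commutator a (h1 \<otimes> h2) \<in> K"
        using commutator_mult_right[of a h1 h2] a h AG by auto
    qed
  qed
  then have "C \<subseteq> K"
    unfolding C_def commutator_subgroup_eq using S(3)
    by (intro generate_subgroup_incl K(1)) auto
  then show ?thesis using K(4) by (meson bdd_above_mono image_mono)
qed

lemma lower_central_series_normal: "lower_central_series G n \<lhd> G"
  by (induction n) (simp_all add: normal_self commutator_subgroup_normal)

lemma bounded_derived:
  assumes T: "normal_generating_set G T"
    and S: "finite S" "S \<subseteq> carrier G" "generate G S = carrier G"
    and nil: "lower_central_series G n = {\<one>}"
  shows "bdd_above (word_norm G T ` derived G (carrier G))"
proof -
  have "lower_central_series G (Suc n) \<subseteq> {\<one>}"
    using commutator_subgroup_subset[OF lower_central_series_normal[of n]] nil by simp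
  then have "bdd_above (word_norm G T ` lower_central_series G (Suc n))"
    by (meson bdd_above_mono finite.intros bdd_above_finite finite_imageI image_mono)
  then have "bdd_above (word_norm G T ` lower_central_series G (Suc 0))"
  proof (induction n)
    case (Suc n)
    then show ?case
      using bounded_commutator_subgroup_step[OF lower_central_series_normal[of n] T S] by simp
  qed
  then show ?thesis by (simp add: commutator_subgroup_self)
qed


section \<open>Homomorphisms to the reals\<close>

lemma additive_int_pow:
  fixes f :: "'a \<Rightarrow> real"
  assumes H: "subgroup H G" and f: "\<And>x y. x \<in> H \<Longrightarrow> y \<in> H \<Longrightarrow> f (x \<otimes> y) = f x + f y"
    and x: "x \<in> H"
  shows "f (x [^] (k::int)) = of_int k * f x"
proof -
  interpret H: subgroup H G by fact
  have pow: "x [^] i \<in> H" for i :: int using subgroup_int_pow_closed[OF H x] .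
  have step: "f (x [^] (i + 1)) = f (x [^] i) + f x" for i :: int
    using f[OF pow x, of i] x by (simp add: int_pow_mult)
  show ?thesis
  proof (induction k rule: int_induct[where k = 0])
    case base
    then show ?case using f[of \<one> \<one>] by simp
  next
    case (step1 i)
    then show ?case using step[of i] by (simp add: algebra_simps)
  next
    case (step2 i)
    then show ?case using step[of "i - 1"] by (simp add: algebra_simps)
  qed
qed

end

context comm_group
begin

text \<open>The value \<open>c\<close> at \<open>x\<close> is an argument, so that besides serving \<open>extend_additive\<close> the lemma can start
  the extension with a nonzero value on an element of infinite order.\<close>

lemma extend_additive_with_value:
  fixes f :: "'a \<Rightarrow> real"
  assumes H: "subgroup H G" and f: "\<And>x y. x \<in> H \<Longrightarrow> y \<in> H \<Longrightarrow> f (x \<otimes> y) = f x + f y"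
    and x: "x \<in> carrier G"
    and c: "\<And>m::int. x [^] m \<in> H \<Longrightarrow> f (x [^] m) = of_int m * c"
  shows "\<exists>H' f'. subgroup H' G \<and> H \<subseteq> H' \<and> x \<in> H' \<and>
    (\<forall>u\<in>H'. \<forall>v\<in>H'. f' (u \<otimes> v) = f' u + f' v) \<and> (\<forall>u\<in>H. f' u = f u) \<and> f' x = c"
proof -
  interpret H: subgroup H G by fact
  define H' where "H' = {h \<otimes> x [^] k | h k. h \<in> H \<and> k \<in> (UNIV :: int set)}"
  define f' where "f' y = (SOME v. \<exists>h\<in>H. \<exists>k::int. y = h \<otimes> x [^] k \<and> v = f h + of_int k * c)" for y
  have unique: "f h + of_int k * c = f h' + of_int l * c"
    if h: "h \<in> H" "h' \<in> H" and eq: "h \<otimes> x [^] k = h' \<otimes> x [^] l" for h h' and k l :: int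
  proof -
    have "x [^] (k - l) = inv h \<otimes> (h \<otimes> x [^] k) \<otimes> inv (x [^] l)"
      using h x by (simp add: int_pow_diff)
    also have "\<dots> = inv h \<otimes> h'"
      unfolding eq using h x by (simp add: m_assoc)
    finally have *: "x [^] (k - l) = inv h \<otimes> h'" .
    then have "x [^] (k - l) \<in> H" using h by simp
    then have "f (inv h \<otimes> h') = of_int (k - l) * c" using c[of "k - l"] * by simp
    moreover have "f h' = f h + f (inv h \<otimes> h')"
      using f[of h "inv h \<otimes> h'"] h by simp
    ultimately show ?thesis by (simp add: algebra_simps)
  qed
  have f': "f' (h \<otimes> x [^] k) = f h + of_int k * c" if "h \<in> H" for h and k :: int
    unfolding f'_def using that unique by (intro some_equality) metis+
  have mult: "(h \<otimes> x [^] k) \<otimes> (h' \<otimes> x [^] l) = (h \<otimes> h') \<otimes> x [^] (k + l)"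
    if "h \<in> H" "h' \<in> H" for h h' and k l :: int
    using that x by (simp add: int_pow_mult m_ac)
  have "subgroup H' G"
  proof (rule subgroupI)
    show "H' \<subseteq> carrier G" unfolding H'_def using x by auto
    show "H' \<noteq> {}" unfolding H'_def using H.one_closed by blast
  next
    fix y assume "y \<in> H'"
    then obtain h and k :: int where y: "h \<in> H" "y = h \<otimes> x [^] k" unfolding H'_def by blast
    then have "inv y = inv h \<otimes> x [^] (- k)"
      using x by (simp add: inv_mult int_pow_neg)
    then show "inv y \<in> H'" unfolding H'_def using y H.m_inv_closed by blast
  next
    fix y z assume "y \<in> H'" "z \<in> H'"
    then obtain h h' and k l :: int
      where "h \<in> H" "y = h \<otimes> x [^] k" "h' \<in> H" "z = h' \<otimes> x [^] l" unfolding H'_def by blast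
    then show "y \<otimes> z \<in> H'" unfolding H'_def using mult[of h h' k l] H.m_closed by blast
  qed
  moreover have inH': "h \<otimes> x [^] k \<in> H'" if "h \<in> H" for h and k :: int
    unfolding H'_def using that by blast
  moreover have "H \<subseteq> H'" using inH'[of _ 0] by (auto dest: H.mem_carrier)
  moreover have "x \<in> H'" using inH'[of \<one> 1] x by (simp add: int_pow_1)
  moreover have "f' (u \<otimes> v) = f' u + f' v" if uv: "u \<in> H'" "v \<in> H'" for u v
  proof -
    obtain h h' and k l :: int
      where "h \<in> H" "u = h \<otimes> x [^] k" "h' \<in> H" "v = h' \<otimes> x [^] l"
      using uv unfolding H'_def by blast
    then show ?thesis using mult[of h h' k l] f' f by (simp add: algebra_simps)
  qed
  moreover have "f' u = f u" if "u \<in> H" for u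
    using f'[OF that, of 0] that H.mem_carrier by simp
  moreover have "f' x = c"
    using f'[of \<one> 1] f[of \<one> \<one>] x by (simp add: int_pow_1)
  ultimately show ?thesis by (intro exI[of _ H'] exI[of _ f']) blast
qed

text \<open>The values already prescribed on the powers of \<open>x\<close> lying in \<open>H\<close> are consistent with a single
  slope \<open>c\<close>, which is found by dividing the value at any one such power by its exponent.\<close>

lemma extend_additive:
  fixes f :: "'a \<Rightarrow> real"
  assumes H: "subgroup H G" and f: "\<And>x y. x \<in> H \<Longrightarrow> y \<in> H \<Longrightarrow> f (x \<otimes> y) = f x + f y"
    and x: "x \<in> carrier G"
  shows "\<exists>H' f'. subgroup H' G \<and> H \<subseteq> H' \<and> x \<in> H' \<and>
    (\<forall>u\<in>H'. \<forall>v\<in>H'. f' (u \<otimes> v) = f' u + f' v) \<and> (\<forall>u\<in>H. f' u = f u)"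
proof -
  have "\<exists>c. \<forall>m::int. x [^] m \<in> H \<longrightarrow> f (x [^] m) = of_int m * c"
  proof (cases "\<exists>n::int. n \<noteq> 0 \<and> x [^] n \<in> H")
    case True
    then obtain n :: int where n: "n \<noteq> 0" "x [^] n \<in> H" by blast
    have "f (x [^] m) = of_int m * (f (x [^] n) / of_int n)" if m: "x [^] m \<in> H" for m :: int
    proof -
      have "of_int n * f (x [^] m) = of_int m * f (x [^] n)"
        using additive_int_pow[OF H f m, of n] additive_int_pow[OF H f n(2), of m] x
        by (simp add: int_pow_pow mult.commute)
      then show ?thesis using n(1) by (simp add: field_simps)
    qed
    then show ?thesis by blast
  next
    case False
    interpret H: subgroup H G by fact
    have "f \<one> = 0" using f[of \<one> \<one>] by simp
    then have "f (x [^] m) = of_int m * 0" if "x [^] m \<in> H" for m :: int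
      using False that by (cases "m = 0") auto
    then show ?thesis by blast
  qed
  then obtain c where c: "\<And>m::int. x [^] m \<in> H \<Longrightarrow> f (x [^] m) = of_int m * c" by blast
  show ?thesis using extend_additive_with_value[OF H f x c] by blast
qed

lemma extend_additive_finite:
  fixes f :: "'a \<Rightarrow> real"
  assumes "finite S" "S \<subseteq> carrier G"
    and H: "subgroup H G" and f: "\<And>x y. x \<in> H \<Longrightarrow> y \<in> H \<Longrightarrow> f (x \<otimes> y) = f x + f y"
  shows "\<exists>H' f'. subgroup H' G \<and> H \<subseteq> H' \<and> S \<subseteq> H' \<and>
    (\<forall>u\<in>H'. \<forall>v\<in>H'. f' (u \<otimes> v) = f' u + f' v) \<and> (\<forall>u\<in>H. f' u = f u)"
  using assms(1,2)
proof (induction rule: finite_induct)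
  case empty
  then show ?case using H f by (intro exI[of _ H] exI[of _ f]) simp
next
  case (insert x S)
  then obtain H1 f1 where 1: "subgroup H1 G" "H \<subseteq> H1" "S \<subseteq> H1"
    "\<forall>u\<in>H1. \<forall>v\<in>H1. f1 (u \<otimes> v) = f1 u + f1 v" "\<forall>u\<in>H. f1 u = f u" by auto
  have x: "x \<in> carrier G" using insert by simp
  obtain H2 f2 where 2: "subgroup H2 G" "H1 \<subseteq> H2" "x \<in> H2"
    "\<forall>u\<in>H2. \<forall>v\<in>H2. f2 (u \<otimes> v) = f2 u + f2 v" "\<forall>u\<in>H1. f2 u = f1 u"
    using extend_additive[OF 1(1) _ x, of f1] 1(4) by blast
  have "\<forall>u\<in>H. f2 u = f u" using 1(2,5) 2(5) by (metis subsetD)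
  then show ?case using 1 2 by (intro exI[of _ H2] exI[of _ f2]) blast
qed

lemma real_hom_nonzero_on_infinite_order:
  assumes S: "finite S" "S \<subseteq> carrier G" "generate G S = carrier G"
    and g: "g \<in> carrier G" and inf: "\<And>m::int. g [^] m = \<one> \<Longrightarrow> m = 0"
  shows "\<exists>f :: 'a \<Rightarrow> real.
    (\<forall>u\<in>carrier G. \<forall>v\<in>carrier G. f (u \<otimes> v) = f u + f v) \<and> f g \<noteq> 0"
proof -
  have "subgroup {\<one>} G" by (rule triv_subgroup)
  from extend_additive_with_value[OF this, of "\<lambda>_. 0" g 1]
  obtain H0 and f0 :: "'a \<Rightarrow> real" where 0: "subgroup H0 G" "g \<in> H0"
    "\<forall>u\<in>H0. \<forall>v\<in>H0. f0 (u \<otimes> v) = f0 u + f0 v" "f0 g = 1"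
    using g inf by auto
  obtain H and f :: "'a \<Rightarrow> real" where H: "subgroup H G" "H0 \<subseteq> H" "S \<subseteq> H"
    "\<forall>u\<in>H. \<forall>v\<in>H. f (u \<otimes> v) = f u + f v" "\<forall>u\<in>H0. f u = f0 u"
    using extend_additive_finite[OF S(1,2) 0(1), of f0] 0(3) by blast
  have "carrier G \<subseteq> H" using generate_subgroup_incl[OF H(3,1)] S(3) by simp
  then have "carrier G = H" using subgroup.subset[OF H(1)] by blast
  moreover have "f g \<noteq> 0" using H(5) 0(2,4) by simp
  ultimately show ?thesis using H(4) by blast
qed

end


section \<open>The dichotomy\<close>

context group
begin

lemma generating_set_imp_normally_finitely_generated:
  assumes S: "finite S" "S \<subseteq> carrier G" "generate G S = carrier G"
  shows "normally_finitely_generated G"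
proof -
  let ?T = "S \<union> m_inv G ` S"
  have T: "?T \<subseteq> carrier G" using S by auto
  have "S \<subseteq> conjugates G ?T"
  proof
    fix x assume x: "x \<in> S"
    then have "x \<in> carrier G" using S(2) by blast
    then have "\<one> \<otimes> x \<otimes> inv \<one> = x" by simp
    then show "x \<in> conjugates G ?T" unfolding conjugates_def
      using x by (metis (mono_tags, lifting) UnI1 mem_Collect_eq one_closed)
  qed
  then have "generate G S \<subseteq> generate G (conjugates G ?T)"
    by (rule mono_generate)
  then have "generate G (conjugates G ?T) = carrier G"
    using generate_incl[OF conjugates_closed[OF T]] unfolding S(3) by (rule subset_antisym[rotated])
  moreover have "\<forall>s\<in>?T. inv s \<in> ?T"
  proof
    fix s assume "s \<in> ?T"
    then consider "s \<in> S" | t where "t \<in> S" "s = inv t" by blast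
    then show "inv s \<in> ?T"
      using S(2) by cases (auto simp: subset_iff)
  qed
  moreover have "finite ?T" using S(1) by simp
  ultimately show ?thesis
    using T unfolding normally_finitely_generated_def normal_generating_set_def by blast
qed

lemma bounded_cyclic_if_power_bounded:
  assumes T: "normal_generating_set G T" and H: "subgroup H G"
    and bH: "bdd_above (word_norm G T ` H)"
    and g: "g \<in> carrier G" and n: "n > 0" "g [^] (n::int) \<in> H"
  shows "bdd_above (word_norm G T ` generate G {g})"
proof -
  let ?R = "(\<lambda>r::int. g [^] r) ` {0..<n}"
  have "bdd_above (word_norm G T ` (H <#> ?R))"
    using g bH subgroup.subset[OF H] by (intro bounded_set_mult[OF T]) auto
  moreover have "generate G {g} \<subseteq> H <#> ?R"
  proof
    fix y assume "y \<in> generate G {g}"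
    then obtain k :: int where k: "y = g [^] k" using generate_pow[OF g] by blast
    have "y = (g [^] n) [^] (k div n) \<otimes> g [^] (k mod n)"
      unfolding k using g by (simp add: int_pow_pow flip: int_pow_mult)
    moreover have "(g [^] n) [^] (k div n) \<in> H" using subgroup_int_pow_closed[OF H n(2)] .
    moreover have "g [^] (k mod n) \<in> ?R" using n(1) by auto
    ultimately show "y \<in> H <#> ?R" unfolding set_mult_def by blast
  qed
  ultimately show ?thesis by (meson bdd_above_mono image_mono)
qed

lemma homogeneous_quasimorphism_if_additive:
  assumes "\<And>u v. u \<in> carrier G \<Longrightarrow> v \<in> carrier G \<Longrightarrow> q (u \<otimes> v) = q u + q v"
  shows "homogeneous_quasimorphism G q"
  unfolding homogeneous_quasimorphism_def
  using additive_int_pow[OF subgroup_self assms] assms by (auto intro!: exI[of _ 0])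

text \<open>A real homomorphism on the abelianization, pulled back to \<open>G\<close>.\<close>

lemma quasimorphism_if_infinite_order_mod_derived:
  assumes S: "finite S" "S \<subseteq> carrier G" "generate G S = carrier G"
    and g: "g \<in> carrier G"
    and inf: "\<And>m::int. g [^] m \<in> derived G (carrier G) \<Longrightarrow> m = 0"
  shows "\<exists>q. homogeneous_quasimorphism G q \<and> q g \<noteq> 0"
proof -
  let ?D = "derived G (carrier G)"
  let ?Q = "G Mod ?D"
  interpret D: normal ?D G by (rule derived_self_is_normal)
  interpret Q: comm_group ?Q by (rule derived_quot_is_comm_group)
  let ?p = "\<lambda>x. ?D #> x"
  interpret p: group_hom G ?Q ?p
    by unfold_locales (rule D.r_coset_hom_Mod)
  have carrQ: "carrier ?Q = ?p ` carrier G"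
    unfolding FactGroup_def RCOSETS_def by auto
  have gen: "generate ?Q (?p ` S) = carrier ?Q"
    unfolding carrQ using p.generate_img[OF S(2)] S(3) by simp
  have inf': "m = 0" if "?p g [^]\<^bsub>?Q\<^esub> m = \<one>\<^bsub>?Q\<^esub>" for m :: int
  proof -
    have "?D #> (g [^] m) = ?D" using that p.hom_int_pow[OF g, of m] by simp
    then have "g [^] m \<in> ?D"
      using coset_join1[OF _ _ D.subgroup_axioms] g by simp
    then show ?thesis by (rule inf)
  qed
  have SQ: "finite (?p ` S)" "?p ` S \<subseteq> carrier ?Q" using S(1,2) carrQ by blast+
  have gQ: "?p g \<in> carrier ?Q" using g carrQ by blast
  obtain f :: "'a set \<Rightarrow> real"
    where f: "\<forall>u\<in>carrier ?Q. \<forall>v\<in>carrier ?Q. f (u \<otimes>\<^bsub>?Q\<^esub> v) = f u + f v" "f (?p g) \<noteq> 0"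
    using Q.real_hom_nonzero_on_infinite_order[OF SQ gen gQ inf'] by blast
  have "homogeneous_quasimorphism G (f \<circ> ?p)"
    using f(1) p.hom_mult carrQ by (intro homogeneous_quasimorphism_if_additive) auto
  then show ?thesis using f(2) by (intro exI[of _ "f \<circ> ?p"]) simp
qed

end

theorem theorem5p8:
  fixes N :: "('a, 'b) monoid_scheme"
  assumes "group N" and "finitely_generated_group N" and "nilpotent_group N"
  shows "bounded_subgroup N (derived N (carrier N)) \<and> bq_dichotomy N"
proof -
  interpret group N by fact
  let ?D = "derived N (carrier N)"
  obtain S where S: "finite S" "S \<subseteq> carrier N" "generate N S = carrier N"
    using assms(2) unfolding finitely_generated_group_def by blast
  obtain n where n: "lower_central_series N n = {\<one>\<^bsub>N\<^esub>}"
    using assms(3) unfolding nilpotent_group_def by blast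
  have nfg: "normally_finitely_generated N"
    by (rule generating_set_imp_normally_finitely_generated[OF S])
  then obtain T where T: "normal_generating_set N T"
    unfolding normally_finitely_generated_def by blast
  have D: "subgroup ?D N" using derived_self_is_normal by (rule normal_imp_subgroup)
  have bD: "bdd_above (word_norm N T ` ?D)" by (rule bounded_derived[OF T S n])
  have "bounded_subgroup N (generate N {g}) \<or> (\<exists>q. homogeneous_quasimorphism N q \<and> q g \<noteq> 0)"
    if g: "g \<in> carrier N" for g
  proof (cases "\<exists>m::int. m \<noteq> 0 \<and> g [^]\<^bsub>N\<^esub> m \<in> ?D")
    case True
    then obtain m :: int where m: "m \<noteq> 0" "g [^]\<^bsub>N\<^esub> m \<in> ?D" by blast
    have "g [^]\<^bsub>N\<^esub> \<bar>m\<bar> \<in> ?D"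
      using m g subgroup.m_inv_closed[OF D m(2)] by (cases "m > 0") (simp_all add: int_pow_neg)
    then have "bdd_above (word_norm N T ` generate N {g})"
      using bounded_cyclic_if_power_bounded[OF T D bD g, of "\<bar>m\<bar>"] m(1) by simp
    moreover have "subgroup (generate N {g}) N" using g by (intro generate_is_subgroup) simp
    ultimately show ?thesis using bounded_subgroup_iff[OF T] by blast
  next
    case False
    then show ?thesis using quasimorphism_if_infinite_order_mod_derived[OF S g] by blast
  qed
  then show ?thesis
    using nfg D bD bounded_subgroup_iff[OF T] unfolding bq_dichotomy_def by blast
qed

end
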